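(* If $n\equiv 0 \pmod 4$, then for every $G\in\mathcal{G}_n$ there is a path in $\mathcal{G}_n^*$ from $G$ to some $H\in\mathcal{K}_n$.
   Context: $\mathcal{G}_n$ is the set of simple 3-regular graphs on vertex set $[n]$. A make move ${\tt make}(yxvwz)$ applies to $G=(V,E)$ when $y,x,v,w,z$ are distinct, $yx,xv,vw,wz\in E$ and $xw,yz\notin E$, and replaces $E$ by $(E\setminus\{xy,wz\})\cup\{xw,yz\}$. A break move ${\tt break}(vxw,yz)$ applies when $vxwv$ is a triangle, $yz\in E$, $\{y,z\}\cap\{v,x,w\}=\emptyset$ and $xy,wz\notin E$, and replaces $E$ by $(E\setminus\{xw,yz\})\cup\{xy,wz\}$. $\mathcal{G}_n^*$ is the graph with vertex set $\mathcal{G}_n$ in which $G,G'$ are adjacent iff some make or break move takes $G$ to $G'$. $\mathcal{K}_n$ is the set of graphs in $\mathcal{G}_n$ consisting of $n/4$ connected components each isomorphic to $K_4$. *)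

theory Defs
  imports "Graph_Theory.Graph_Theory"
begin

text \<open>
  A simple graph is a \<^locale>\<open>pair_graph\<close>: a finite, loop-free, symmetric digraph whose arcs are
  pairs of vertices. An undirected edge \<open>uv\<close> is the pair of arcs \<open>(u, v)\<close> and \<open>(v, u)\<close>, so the
  degree of a vertex is its \<^const>\<open>out_degree\<close>, and the connected components of a graph are its
  strongly connected components \<^const>\<open>pre_digraph.sccs\<close>.
\<close>

definition edge :: "'a \<Rightarrow> 'a \<Rightarrow> ('a \<times> 'a) set" where
  "edge u v = {(u, v), (v, u)}"

definition cubic_graphs :: "nat \<Rightarrow> nat pair_pre_digraph set" where
  "cubic_graphs n = {G. pair_graph G \<and> pverts G = {1..n} \<and>
     (\<forall>v \<in> pverts G. out_degree (with_proj G) v = 3)}"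

definition make_applies ::
    "'a pair_pre_digraph \<Rightarrow> 'a \<Rightarrow> 'a \<Rightarrow> 'a \<Rightarrow> 'a \<Rightarrow> 'a \<Rightarrow> bool" where
  "make_applies G y x v w z \<longleftrightarrow>
     distinct [y, x, v, w, z] \<and>
     edge y x \<subseteq> parcs G \<and> edge x v \<subseteq> parcs G \<and> edge v w \<subseteq> parcs G \<and> edge w z \<subseteq> parcs G \<and>
     \<not> edge x w \<subseteq> parcs G \<and> \<not> edge y z \<subseteq> parcs G"

definition make_move ::
    "'a pair_pre_digraph \<Rightarrow> 'a \<Rightarrow> 'a \<Rightarrow> 'a \<Rightarrow> 'a \<Rightarrow> 'a \<Rightarrow> 'a pair_pre_digraph" where
  "make_move G y x v w z =
     G\<lparr>parcs := (parcs G - (edge x y \<union> edge w z)) \<union> (edge x w \<union> edge y z)\<rparr>"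

definition break_applies ::
    "'a pair_pre_digraph \<Rightarrow> 'a \<Rightarrow> 'a \<Rightarrow> 'a \<Rightarrow> 'a \<Rightarrow> 'a \<Rightarrow> bool" where
  "break_applies G v x w y z \<longleftrightarrow>
     distinct [v, x, w] \<and>
     edge v x \<subseteq> parcs G \<and> edge x w \<subseteq> parcs G \<and> edge w v \<subseteq> parcs G \<and>
     edge y z \<subseteq> parcs G \<and> {y, z} \<inter> {v, x, w} = {} \<and>
     \<not> edge x y \<subseteq> parcs G \<and> \<not> edge w z \<subseteq> parcs G"

definition break_move ::
    "'a pair_pre_digraph \<Rightarrow> 'a \<Rightarrow> 'a \<Rightarrow> 'a \<Rightarrow> 'a \<Rightarrow> 'a \<Rightarrow> 'a pair_pre_digraph" where
  "break_move G v x w y z =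
     G\<lparr>parcs := (parcs G - (edge x w \<union> edge y z)) \<union> (edge x y \<union> edge w z)\<rparr>"

definition triangle_move :: "'a pair_pre_digraph \<Rightarrow> 'a pair_pre_digraph \<Rightarrow> bool" where
  "triangle_move G G' \<longleftrightarrow>
     (\<exists>y x v w z. make_applies G y x v w z \<and> G' = make_move G y x v w z) \<or>
     (\<exists>v x w y z. break_applies G v x w y z \<and> G' = break_move G v x w y z)"

definition flip_graph :: "nat \<Rightarrow> nat pair_pre_digraph pair_pre_digraph" where
  "flip_graph n =
     \<lparr>pverts = cubic_graphs n,
      parcs = {(G, G'). G \<in> cubic_graphs n \<and> G' \<in> cubic_graphs n \<and> triangle_move G G'}\<rparr>"

definition complete_graph :: "nat \<Rightarrow> nat pair_pre_digraph" where
  "complete_graph k =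
     \<lparr>pverts = {1..k}, parcs = {(u, v). u \<in> {1..k} \<and> v \<in> {1..k} \<and> u \<noteq> v}\<rparr>"

definition K4_graphs :: "nat \<Rightarrow> nat pair_pre_digraph set" where
  "K4_graphs n = {G \<in> cubic_graphs n.
     4 * card (pre_digraph.sccs (with_proj G)) = n \<and>
     (\<forall>C \<in> pre_digraph.sccs (with_proj G). digraph_iso C (with_proj (complete_graph 4)))}"

text \<open>
  Make and break moves are inverse to each other, so \<^const>\<open>flip_graph\<close> is an undirected graph
  although its arcs are defined by moves in one direction.
\<close>

lemma cubic_graphs_edge_iff:
  assumes "G \<in> cubic_graphs n"
  shows "edge u v \<subseteq> parcs G \<longleftrightarrow> (u, v) \<in> parcs G"
    and "(u, v) \<in> parcs G \<longleftrightarrow> (v, u) \<in> parcs G"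
    and "(u, v) \<in> parcs G \<Longrightarrow> u \<noteq> v"
proof -
  interpret pair_graph G using assms by (simp add: cubic_graphs_def)
  show "edge u v \<subseteq> parcs G \<longleftrightarrow> (u, v) \<in> parcs G"
    by (auto simp: edge_def intro: arcs_symmetric)
  show "(u, v) \<in> parcs G \<longleftrightarrow> (v, u) \<in> parcs G" by (auto intro: arcs_symmetric)
  show "(u, v) \<in> parcs G \<Longrightarrow> u \<noteq> v" by (rule no_loops')
qed

lemma triangle_move_sym:
  assumes G: "G \<in> cubic_graphs n" and move: "triangle_move G G'"
  shows "triangle_move G' G"
proof -
  note E = cubic_graphs_edge_iff[OF G]
  show ?thesis
    using move unfolding triangle_move_def
  proof (elim disjE exE conjE)
    fix y x v w z
    assume A: "make_applies G y x v w z" and G': "G' = make_move G y x v w z"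
    have "break_applies G' v x w y z"
      using A E(2) unfolding make_applies_def break_applies_def E(1) G'
      by (auto simp: make_move_def edge_def)
    moreover have "parcs (break_move G' v x w y z) = parcs G"
      using A E(2) unfolding make_applies_def E(1) G'
      by (auto simp: make_move_def break_move_def edge_def)
    hence "G = break_move G' v x w y z"
      by (simp add: G' make_move_def break_move_def)
    ultimately show "(\<exists>y x v w z. make_applies G' y x v w z \<and> G = make_move G' y x v w z) \<or>
      (\<exists>v x w y z. break_applies G' v x w y z \<and> G = break_move G' v x w y z)" by blast
  next
    fix v x w y z
    assume A: "break_applies G v x w y z" and G': "G' = break_move G v x w y z"
    have "y \<noteq> z" using A E(3) unfolding break_applies_def E(1) by blast
    hence "make_applies G' y x v w z"
      using A E(2) unfolding make_applies_def break_applies_def E(1) G'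
      by (auto simp: break_move_def edge_def)
    moreover have "parcs (make_move G' y x v w z) = parcs G"
      using A E(2) unfolding break_applies_def E(1) G'
      by (auto simp: make_move_def break_move_def edge_def)
    hence "G = make_move G' y x v w z"
      by (simp add: G' make_move_def break_move_def)
    ultimately show "(\<exists>y x v w z. make_applies G' y x v w z \<and> G = make_move G' y x v w z) \<or>
      (\<exists>v x w y z. break_applies G' v x w y z \<and> G = break_move G' v x w y z)" by blast
  qed
qed

lemma symmetric_flip_graph: "symmetric (with_proj (flip_graph n))"
  by (auto simp: symmetric_def flip_graph_def intro!: symI triangle_move_sym)

end

theory Submission
  imports Defs "HOL-Library.Disjoint_Sets"
begin

text \<open>
  It suffices to create one \<open>K\<^sub>4\<close>: it is a component, so it can be removed and the rest treated
  inductively. A diamond (\<open>K\<^sub>4\<close> minus the edge \<open>cd\<close>) whose ends \<open>c, d\<close> have distinct nonadjacent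
  outer neighbours \<open>e, f\<close> is completed by one make move along \<open>e c a d f\<close>; if \<open>e = f\<close> or \<open>ef\<close> is an
  edge, one earlier make move outside the diamond separates them. A triangle becomes a diamond by
  a make move through an outer neighbour, unless the component is the prism or a triangle
  joined by a perfect matching to the three-element side of \<open>K\<^bsub>2,3\<^esub>\<close>. The latter is handled by
  two make moves inside it, the prism by a break move with an edge outside it, which exists
  because the number of remaining vertices is divisible by 4 and hence not 6. Finally, in a
  nonempty triangle-free cubic graph some make move always applies.
\<close>

section \<open>Switches on cubic edge sets\<close>

text \<open>Make and break moves are the same exchange of two edges: make(yxvwz) is
  \<open>switch E x y w z\<close>, and break(vxw,yz) is \<open>switch E x w y z\<close>, with the
  middle arguments exchanged.\<close>

definition switch :: "('a \<times> 'a) set \<Rightarrow> 'a \<Rightarrow> 'a \<Rightarrow> 'a \<Rightarrow> 'a \<Rightarrow> ('a \<times> 'a) set" where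
  "switch E x y w z = E - (edge x y \<union> edge w z) \<union> (edge x w \<union> edge y z)"

text \<open>The vertex set is a separate parameter so that the induction can delete the vertices of
  a finished component.\<close>

definition cubic_on :: "'a set \<Rightarrow> ('a \<times> 'a) set \<Rightarrow> bool" where
  "cubic_on R E \<longleftrightarrow> finite R \<and> E \<subseteq> R \<times> R \<and> sym E \<and> irrefl E \<and> (\<forall>v\<in>R. card (E `` {v}) = 3)"

inductive tri_step :: "('a \<times> 'a) set \<Rightarrow> ('a \<times> 'a) set \<Rightarrow> bool" where
  make: "tri_step E (switch E x y w z)"
    if "distinct [y, x, v, w, z]" "(y, x) \<in> E" "(x, v) \<in> E" "(v, w) \<in> E" "(w, z) \<in> E"
      "(x, w) \<notin> E" "(y, z) \<notin> E"
| break: "tri_step E (switch E x w y z)"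
    if "distinct [v, x, w, y, z]" "(v, x) \<in> E" "(x, w) \<in> E" "(w, v) \<in> E" "(y, z) \<in> E"
      "(x, y) \<notin> E" "(w, z) \<notin> E"

definition is_K4 :: "('a \<times> 'a) set \<Rightarrow> 'a \<Rightarrow> 'a \<Rightarrow> 'a \<Rightarrow> 'a \<Rightarrow> bool" where
  "is_K4 E a b c d \<longleftrightarrow> distinct [a, b, c, d] \<and>
     {(a, b), (a, c), (a, d), (b, c), (b, d), (c, d)} \<subseteq> E"

definition reaches_K4 :: "('a \<times> 'a) set \<Rightarrow> bool" where
  "reaches_K4 E \<longleftrightarrow> (\<exists>E' a b c d. tri_step\<^sup>*\<^sup>* E E' \<and> is_K4 E' a b c d)"

text \<open>The hubs are \<open>a\<close> and \<open>b\<close>, the ends \<open>c\<close> and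
  \<open>d\<close>. The nonedge \<open>cd\<close> separates the diamond from a complete
  graph.\<close>

definition diamond :: "('a \<times> 'a) set \<Rightarrow> 'a \<Rightarrow> 'a \<Rightarrow> 'a \<Rightarrow> 'a \<Rightarrow> bool" where
  "diamond E a b c d \<longleftrightarrow> distinct [a, b, c, d] \<and>
     {(a, b), (a, c), (a, d), (b, c), (b, d)} \<subseteq> E \<and> (c, d) \<notin> E"

lemma is_K4_reaches: "is_K4 E a b c d \<Longrightarrow> reaches_K4 E"
  unfolding reaches_K4_def by (meson rtranclp.rtrancl_refl)

lemma reaches_K4_step: "tri_step E E' \<Longrightarrow> reaches_K4 E' \<Longrightarrow> reaches_K4 E"
  unfolding reaches_K4_def by (meson converse_rtranclp_into_rtranclp)

lemma cubic_on_sym: "cubic_on R E \<Longrightarrow> (u, v) \<in> E \<Longrightarrow> (v, u) \<in> E"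
  by (auto simp: cubic_on_def dest: symD)

lemma cubic_on_irrefl: "cubic_on R E \<Longrightarrow> (u, v) \<in> E \<Longrightarrow> u \<noteq> v"
  by (auto simp: cubic_on_def irrefl_def)

text \<open>This lemma and its variants for one, two or three known neighbours turn the degree
  condition into explicit neighbour lists, from which adjacency and nonadjacency are read
  off.\<close>

lemma cubic_on_nbrs:
  assumes "cubic_on R E" "v \<in> R"
  obtains a b c where "distinct [a, b, c]" "\<And>u. (v, u) \<in> E \<longleftrightarrow> u = a \<or> u = b \<or> u = c"
proof -
  have "card (E `` {v}) = 3" using assms by (auto simp: cubic_on_def)
  then obtain a b c where "E `` {v} = {a, b, c}" "a \<noteq> b" "b \<noteq> c" "a \<noteq> c"
    by (auto simp: card_3_iff)
  then show ?thesis by (intro that[of a b c]) auto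
qed

lemma cubic_on_nbrs1:
  assumes "cubic_on R E" "(v, a) \<in> E"
  obtains b c where "distinct [a, b, c]" "\<And>u. (v, u) \<in> E \<longleftrightarrow> u = a \<or> u = b \<or> u = c"
proof -
  have "v \<in> R" using assms by (auto simp: cubic_on_def)
  then obtain p q r where "distinct [p, q, r]" "\<And>u. (v, u) \<in> E \<longleftrightarrow> u = p \<or> u = q \<or> u = r"
    using cubic_on_nbrs[OF assms(1)] by metis
  with assms(2) show ?thesis
    using that[of q r] that[of p r] that[of p q] by auto
qed

lemma cubic_on_nbrs2:
  assumes "cubic_on R E" "(v, a) \<in> E" "(v, b) \<in> E" "a \<noteq> b"
  obtains c where "distinct [a, b, c]" "\<And>u. (v, u) \<in> E \<longleftrightarrow> u = a \<or> u = b \<or> u = c"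
proof -
  obtain p q where "distinct [a, p, q]" "\<And>u. (v, u) \<in> E \<longleftrightarrow> u = a \<or> u = p \<or> u = q"
    using cubic_on_nbrs1[OF assms(1,2)] by metis
  with assms(3,4) show ?thesis
    using that[of q] that[of p] by auto
qed

lemma cubic_on_nbrs3:
  assumes "cubic_on R E" "(v, a) \<in> E" "(v, b) \<in> E" "(v, c) \<in> E" "distinct [a, b, c]"
  shows "(v, u) \<in> E \<longleftrightarrow> u = a \<or> u = b \<or> u = c"
proof -
  obtain d where "\<And>u. (v, u) \<in> E \<longleftrightarrow> u = a \<or> u = b \<or> u = d"
    using cubic_on_nbrs2[OF assms(1,2,3)] assms(5) by auto
  then show ?thesis using assms by auto
qed

lemma switch_iff:
  "(s, t) \<in> switch E x y w z \<longleftrightarrow>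
     (s, t) \<in> E \<and> (s, t) \<notin> {(x, y), (y, x), (w, z), (z, w)} \<or>
     (s, t) \<in> {(x, w), (w, x), (y, z), (z, y)}"
  by (auto simp: switch_def edge_def)

lemma cubic_on_switch:
  assumes cub: "cubic_on R E" and dist: "distinct [x, y, w, z]"
    and "(x, y) \<in> E" "(w, z) \<in> E" "(x, w) \<notin> E" "(y, z) \<notin> E"
  shows "cubic_on R (switch E x y w z)"
proof -
  note sy = cubic_on_sym[OF cub]
  \<comment> \<open>Each of the four switched vertices loses one neighbour and gains a new one; all
    other neighbourhoods stay the same.\<close>
  have swap: "card (insert s (N - {t})) = 3" if "card N = 3" "t \<in> N" "s \<notin> N" for s t :: 'a and N
  proof -
    have "finite N" using that(1) by (simp add: card_ge_0_finite)
    then show ?thesis using that by (simp add: card_insert_if)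
  qed
  have R: "x \<in> R" "y \<in> R" "w \<in> R" "z \<in> R" using assms by (auto simp: cubic_on_def)
  have "card (switch E x y w z `` {v}) = 3" if v: "v \<in> R" for v
  proof -
    have c: "card (E `` {v}) = 3" using cub v by (auto simp: cubic_on_def)
    consider "v = x" | "v = y" | "v = w" | "v = z" | "v \<notin> {x, y, w, z}" by blast
    then show ?thesis
    proof cases
      case 1
      then have "switch E x y w z `` {v} = insert w (E `` {v} - {y})"
        using dist by (auto simp: switch_iff)
      then show ?thesis using swap[OF c, of y w] 1 assms by auto
    next
      case 2
      then have "switch E x y w z `` {v} = insert z (E `` {v} - {x})"
        using dist by (auto simp: switch_iff)
      then show ?thesis using swap[OF c, of x z] 2 assms sy by auto
    next
      case 3
      then have "switch E x y w z `` {v} = insert x (E `` {v} - {z})"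
        using dist by (auto simp: switch_iff)
      then show ?thesis using swap[OF c, of z x] 3 assms sy by auto
    next
      case 4
      then have "switch E x y w z `` {v} = insert y (E `` {v} - {w})"
        using dist by (auto simp: switch_iff)
      then show ?thesis using swap[OF c, of w y] 4 assms sy by auto
    next
      case 5
      then have "switch E x y w z `` {v} = E `` {v}" by (auto simp: switch_iff)
      then show ?thesis using c by simp
    qed
  qed
  moreover have "sym (switch E x y w z)" using sy by (auto simp: switch_iff intro!: symI)
  moreover have "irrefl (switch E x y w z)"
    using dist cubic_on_irrefl[OF cub] by (auto simp: switch_iff irrefl_def)
  moreover have "switch E x y w z \<subseteq> R \<times> R"
    using cub R by (auto simp: cubic_on_def switch_def edge_def)
  ultimately show ?thesis using cub by (simp add: cubic_on_def)
qed

lemma cubic_on_tri_step: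
  assumes "tri_step E E'" "cubic_on R E"
  shows "cubic_on R E'"
  using assms(1)
proof cases
  case (make y x v w z)
  with cubic_on_sym[OF assms(2) make(3)] show ?thesis
    using cubic_on_switch[OF assms(2), of x y w z] by auto
next
  case (break v x w y z)
  with cubic_on_sym[OF assms(2)] show ?thesis
    using cubic_on_switch[OF assms(2), of x w y z] by auto
qed

lemma cubic_on_tri_steps:
  "tri_step\<^sup>*\<^sup>* E E' \<Longrightarrow> cubic_on R E \<Longrightarrow> cubic_on R E'"
  by (induction rule: rtranclp_induct) (auto intro: cubic_on_tri_step)

section \<open>Completing a diamond\<close>

lemma diamond_reaches_K4_nonadjacent:
  assumes cub: "cubic_on R E" and dia: "diamond E a b c d"
    and ends: "(c, e) \<in> E" "(d, f) \<in> E" "(e, f) \<notin> E" "e \<notin> {a, b}" "f \<notin> {a, b}" "e \<noteq> f"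
  shows "reaches_K4 E"
proof (rule reaches_K4_step)
  note E = cubic_on_sym[OF cub] cubic_on_irrefl[OF cub]
  show "tri_step E (switch E c e d f)"
    by (rule tri_step.make[where v = a]) (use dia ends E in \<open>auto simp: diamond_def\<close>)
  have "is_K4 (switch E c e d f) a b c d"
    using dia ends by (auto simp: diamond_def is_K4_def switch_iff)
  then show "reaches_K4 (switch E c e d f)" by (rule is_K4_reaches)
qed

lemma diamond_reaches_K4:
  assumes cub: "cubic_on R E" and dia: "diamond E a b c d"
  shows "reaches_K4 E"
proof -
  note sy = cubic_on_sym[OF cub] and irr = cubic_on_irrefl[OF cub]
  have D: "distinct [a, b, c, d]" "(a, b) \<in> E" "(a, c) \<in> E" "(a, d) \<in> E" "(b, c) \<in> E" "(b, d) \<in> E"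
    "(c, d) \<notin> E"
    using dia by (auto simp: diamond_def)
  \<comment> \<open>The hubs have all their neighbours inside the diamond, so edges leave it only at
    \<open>c\<close> and \<open>d\<close>. This keeps the auxiliary paths below away from
    it.\<close>
  have Na: "(a, u) \<in> E \<longleftrightarrow> u = b \<or> u = c \<or> u = d" for u
    using D by (intro cubic_on_nbrs3[OF cub]) auto
  have Nb: "(b, u) \<in> E \<longleftrightarrow> u = a \<or> u = c \<or> u = d" for u
    using D sy by (intro cubic_on_nbrs3[OF cub]) auto
  obtain e where e: "distinct [a, b, e]" "\<And>u. (c, u) \<in> E \<longleftrightarrow> u = a \<or> u = b \<or> u = e"
    using cubic_on_nbrs2[OF cub, of c a b] D(1) sy[OF D(3)] sy[OF D(5)] by auto
  obtain f where f: "distinct [a, b, f]" "\<And>u. (d, u) \<in> E \<longleftrightarrow> u = a \<or> u = b \<or> u = f"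
    using cubic_on_nbrs2[OF cub, of d a b] D(1) sy[OF D(4)] sy[OF D(6)] by auto
  have ce: "(c, e) \<in> E" and df: "(d, f) \<in> E" using e f by auto
  have ne: "e \<noteq> d" "f \<noteq> c" "e \<noteq> c" "f \<noteq> d"
    using D(7) ce df sy[OF df] irr by metis+
  consider (far) "e \<noteq> f" "(e, f) \<notin> E" | (adj) "e \<noteq> f" "(e, f) \<in> E" | (same) "e = f" by blast
  then show ?thesis
  proof cases
    case far
    then show ?thesis using diamond_reaches_K4_nonadjacent[OF cub dia ce df] e(1) f(1) by auto
  next
    case adj
    obtain g where g: "distinct [c, f, g]" "\<And>u. (e, u) \<in> E \<longleftrightarrow> u = c \<or> u = f \<or> u = g"
      using cubic_on_nbrs2[OF cub, of e c f] adj sy[OF ce] ne by metis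
    obtain h where h: "distinct [d, e, h]" "\<And>u. (f, u) \<in> E \<longleftrightarrow> u = d \<or> u = e \<or> u = h"
      using cubic_on_nbrs2[OF cub, of f d e] sy[OF adj(2)] sy[OF df] ne by metis
    have eg: "(e, g) \<in> E" using g by simp
    obtain k1 k2 where k12: "distinct [e, k1, k2]" "\<And>u. (g, u) \<in> E \<longleftrightarrow> u = e \<or> u = k1 \<or> u = k2"
      using cubic_on_nbrs1[OF cub sy[OF eg]] by metis
    \<comment> \<open>The vertex \<open>g\<close> may be adjacent to \<open>f\<close>; of its two
      neighbours other than \<open>e\<close>, at least one is not \<open>f\<close>.\<close>
    obtain k where k: "(g, k) \<in> E" "k \<noteq> e" "k \<noteq> f"
      using k12 by (cases "k1 = f") auto
    obtain z1 z2 where z12: "distinct [g, z1, z2]" "\<And>u. (k, u) \<in> E \<longleftrightarrow> u = g \<or> u = z1 \<or> u = z2"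
      using cubic_on_nbrs1[OF cub sy[OF k(1)]] by metis
    have gD: "g \<notin> {a, b, c, d}"
      using Na[of e] Nb[of e] e(1) f(1) f(2)[of e] ne sy[OF eg] adj(1) irr[OF ce] g(1) by auto
    have kD: "k \<notin> {a, b, c, d}"
      using Na[of g] Nb[of g] e(2)[of g] f(2)[of g] gD k sy[OF k(1)] g(1) irr[OF eg] by auto
    have fk: "k = h" if "(k, f) \<in> E"
      using h(2)[of k] sy[OF that] k kD by auto
    \<comment> \<open>Of the two neighbours of \<open>k\<close> other than \<open>g\<close>, at most
      one is forbidden: if \<open>k = h\<close>, then \<open>h\<close> is excluded by irreflexivity,
      and otherwise \<open>k\<close> is not adjacent to \<open>f\<close>. Avoiding \<open>h\<close>,
      the last neighbour of \<open>f\<close>, makes \<open>fz\<close> a nonedge.\<close>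
    obtain z where z: "(k, z) \<in> E" "z \<noteq> g" "z \<noteq> f" "z \<noteq> h"
    proof (cases "k = h")
      case True
      then show ?thesis using that[of z1] that[of z2] z12 irr[of h] by auto
    next
      case False
      then show ?thesis using that[of z1] that[of z2] z12 fk by auto
    qed
    have ze: "z \<noteq> e" using g(2)[of k] z(1) sy[OF z(1)] k kD irr[OF k(1)] by auto
    have zD: "z \<notin> {a, b, c, d}"
      using Na[of k] Nb[of k] e(2)[of k] f(2)[of k] kD k z sy[OF z(1)] by auto
    have gf: "g \<noteq> f" "g \<noteq> k" "k \<noteq> z" "g \<noteq> e" using g irr[OF k(1)] irr[OF z(1)] irr[OF eg] by auto
    have dis: "a \<noteq> z" "b \<noteq> z" "c \<noteq> z" "d \<noteq> z" "a \<noteq> k" "b \<noteq> k" "c \<noteq> k" "d \<noteq> k"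
      "a \<noteq> e" "b \<noteq> e" "a \<noteq> f" "b \<noteq> f" "k \<noteq> e" "k \<noteq> f" "z \<noteq> e" "z \<noteq> f"
      using zD kD e(1) f(1) k z ze by auto
    \<comment> \<open>The make move along \<open>f e g k z\<close> removes the obstructing edge
      \<open>ef\<close> and leaves the diamond and the edges \<open>ce\<close> and \<open>df\<close>
      untouched.\<close>
    let ?E = "switch E e f k z"
    have st: "tri_step E ?E"
    proof (rule tri_step.make)
      show "distinct [f, e, g, k, z]" using adj(1) gf k z ze by auto
      show "(f, e) \<in> E" "(e, g) \<in> E" "(g, k) \<in> E" "(k, z) \<in> E"
        using sy[OF adj(2)] eg k(1) z(1) by simp_all
      show "(e, k) \<notin> E" using g(2)[of k] kD k gf by simp
      show "(f, z) \<notin> E" using h(2)[of z] zD ze z by simp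
    qed
    have "diamond ?E a b c d" "(c, e) \<in> ?E" "(d, f) \<in> ?E" "(e, f) \<notin> ?E"
      using D ce df ne dis adj(1) by (simp_all add: diamond_def switch_iff)
    then have "reaches_K4 ?E"
      by (rule diamond_reaches_K4_nonadjacent[OF cubic_on_tri_step[OF st cub]])
        (use e(1) f(1) adj(1) in auto)
    then show ?thesis by (rule reaches_K4_step[OF st])
  next
    case same
    have cd: "d \<noteq> c" using D(1) by auto
    have de: "(d, e) \<in> E" using df same by simp
    obtain g where g: "distinct [c, d, g]" "\<And>u. (e, u) \<in> E \<longleftrightarrow> u = c \<or> u = d \<or> u = g"
      using cubic_on_nbrs2[OF cub sy[OF ce] sy[OF de]] D(1) by auto
    have eg: "(e, g) \<in> E" using g by simp
    obtain p q where pq: "distinct [e, p, q]" "\<And>u. (g, u) \<in> E \<longleftrightarrow> u = e \<or> u = p \<or> u = q"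
      using cubic_on_nbrs1[OF cub sy[OF eg]] by metis
    have gp: "(g, p) \<in> E" using pq by simp
    obtain z z' where z: "distinct [g, z, z']" "\<And>u. (p, u) \<in> E \<longleftrightarrow> u = g \<or> u = z \<or> u = z'"
      using cubic_on_nbrs1[OF cub sy[OF gp]] by metis
    have pz: "(p, z) \<in> E" using z by simp
    have gD: "g \<notin> {a, b, c, d}"
      using Na[of e] Nb[of e] e(1) ne sy[OF eg] g(1) by auto
    have pD: "p \<notin> {a, b, c, d}"
      using Na[of g] Nb[of g] e(2)[of g] f(2)[of g] gD sy[OF gp] irr[OF eg] same by auto
    have zD: "z \<notin> {a, b, c, d}"
      using Na[of p] Nb[of p] e(2)[of p] f(2)[of p] pD sy[OF pz] pq same by auto
    have ze: "z \<noteq> e" using g(2)[of p] pD sy[OF pz] irr[OF gp] by auto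
    have zne: "(z, e) \<notin> E" using g(2)[of z] z(1) zD sy[of z e] by auto
    have gf: "g \<noteq> p" "p \<noteq> z" "g \<noteq> e" using irr[OF gp] irr[OF pz] irr[OF eg] by auto
    have dis: "a \<noteq> z" "b \<noteq> z" "c \<noteq> z" "d \<noteq> z" "a \<noteq> p" "b \<noteq> p" "c \<noteq> p" "d \<noteq> p"
      "a \<noteq> e" "b \<noteq> e" "z \<noteq> e" "p \<noteq> z" "p \<noteq> e"
      using zD pD e(1) ze gf pq(1) by auto
    \<comment> \<open>The make move along \<open>c e g p z\<close> replaces the outer neighbour
      \<open>e\<close> of \<open>c\<close> by \<open>z\<close>, while \<open>d\<close> keeps
      \<open>e\<close>. Since \<open>e\<close> has only the neighbours \<open>c\<close>,
      \<open>d\<close>, \<open>g\<close> before the move, \<open>z\<close> and \<open>e\<close> are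
      nonadjacent.\<close>
    let ?E = "switch E e c p z"
    have st: "tri_step E ?E"
    proof (rule tri_step.make)
      show "distinct [c, e, g, p, z]" using gD pD zD gf z(1) pq(1) ze ne by auto
      show "(c, e) \<in> E" "(e, g) \<in> E" "(g, p) \<in> E" "(p, z) \<in> E" by fact+
      show "(e, p) \<notin> E" using g(2)[of p] pD gf by simp
      show "(c, z) \<notin> E" using e(2)[of z] zD ze by simp
    qed
    have "diamond ?E a b c d" "(c, z) \<in> ?E" "(d, e) \<in> ?E" "(z, e) \<notin> ?E"
      using D cd ce de ne dis zne by (simp_all add: diamond_def switch_iff)
    then have "reaches_K4 ?E"
      by (rule diamond_reaches_K4_nonadjacent[OF cubic_on_tri_step[OF st cub]])
        (use e(1) zD ze in auto)
    then show ?thesis by (rule reaches_K4_step[OF st])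
  qed
qed

section \<open>From triangles to diamonds\<close>

text \<open>The four vertices span a complete graph or a diamond with hubs \<open>v\<close> and
  \<open>x\<close>, according to whether \<open>wu\<close> is an edge.\<close>

lemma triangle_shared_nbr_reaches_K4:
  assumes cub: "cubic_on R E" and tri: "(v, x) \<in> E" "(v, w) \<in> E" "(x, w) \<in> E"
    and u: "(v, u) \<in> E" "(x, u) \<in> E" "u \<noteq> w"
  shows "reaches_K4 E"
proof (cases "(w, u) \<in> E")
  case True
  have "is_K4 E v x w u"
    using True tri u tri[THEN cubic_on_irrefl[OF cub]] u(1,2)[THEN cubic_on_irrefl[OF cub]]
    by (auto simp: is_K4_def)
  then show ?thesis by (rule is_K4_reaches)
next
  case False
  have "diamond E v x w u"
    using False tri u tri[THEN cubic_on_irrefl[OF cub]] u(1,2)[THEN cubic_on_irrefl[OF cub]]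
    by (auto simp: diamond_def)
  then show ?thesis by (rule diamond_reaches_K4[OF cub])
qed

lemma triangle_extends_to_diamond:
  assumes cub: "cubic_on R E" and tri: "(v, x) \<in> E" "(v, w) \<in> E" "(x, w) \<in> E"
    and out: "(v, v') \<in> E" "(x, x') \<in> E" "v' \<notin> {x, w}" "x' \<notin> {v, w}" "v' \<noteq> x'"
    and y: "(v', y) \<in> E" "y \<noteq> v" "y \<noteq> x'" "(y, x') \<notin> E"
  shows "reaches_K4 E"
proof (cases "(x, v') \<in> E \<or> (w, v') \<in> E")
  case True
  then show ?thesis
    using triangle_shared_nbr_reaches_K4[OF cub tri out(1)] out(3) cubic_on_sym[OF cub tri(3)]
      triangle_shared_nbr_reaches_K4[OF cub tri(2,1) _ out(1)] by auto
next
  case False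
  note sy = cubic_on_sym[OF cub] and irr = cubic_on_irrefl[OF cub]
  have yv: "y \<noteq> x" "y \<noteq> w" "(v', x) \<notin> E"
    using False y(1)[THEN sy] sy[of v' x] by auto
  note ne = tri[THEN irr] out(1,2)[THEN irr] y(1)[THEN irr]
  let ?E = "switch E v' y x x'"
  have st: "tri_step E ?E"
    by (rule tri_step.make[where v = v])
      (use tri out y yv ne y(1)[THEN sy] out(1)[THEN sy] in auto)
  have "diamond ?E v x w v'"
    using tri out y yv ne False by (auto simp: diamond_def switch_iff)
  from reaches_K4_step[OF st diamond_reaches_K4[OF cubic_on_tri_step[OF st cub] this]]
  show ?thesis .
qed

text \<open>The prism is a whole component, so \<open>card R \<noteq> 6\<close> supplies an edge
  \<open>yz\<close> outside it. A break move opens the triangle \<open>v x w\<close> with the help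
  of \<open>yz\<close>, and a make move then gives \<open>v\<close> the neighbour
  \<open>x'\<close>.\<close>

lemma prism_reaches_K4:
  assumes cub: "cubic_on R E" and card: "card R \<noteq> 6"
    and dist: "distinct [v, x, w, v', x', w']"
    and tri: "(v, x) \<in> E" "(v, w) \<in> E" "(x, w) \<in> E"
    and tri': "(v', x') \<in> E" "(v', w') \<in> E" "(x', w') \<in> E"
    and rungs: "(v, v') \<in> E" "(x, x') \<in> E" "(w, w') \<in> E"
  shows "reaches_K4 E"
proof -
  note sy = cubic_on_sym[OF cub] and irr = cubic_on_irrefl[OF cub]
  note adj_rev = tri[THEN sy] tri'[THEN sy] rungs[THEN sy]
  let ?S = "set [v, x, w, v', x', w']"
  have nbrs: "(v, u) \<in> E \<longleftrightarrow> u = x \<or> u = w \<or> u = v'" "(x, u) \<in> E \<longleftrightarrow> u = v \<or> u = w \<or> u = x'"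
    "(w, u) \<in> E \<longleftrightarrow> u = v \<or> u = x \<or> u = w'" "(v', u) \<in> E \<longleftrightarrow> u = x' \<or> u = w' \<or> u = v"
    "(x', u) \<in> E \<longleftrightarrow> u = v' \<or> u = w' \<or> u = x" "(w', u) \<in> E \<longleftrightarrow> u = v' \<or> u = x' \<or> u = w" for u
    by (rule cubic_on_nbrs3[OF cub]; use dist in \<open>auto simp: tri tri' rungs adj_rev\<close>)+
  have closed: "t \<in> ?S" if "s \<in> ?S" "(s, t) \<in> E" for s t
    using that nbrs by auto
  have "card ?S = 6" using dist by (simp only: distinct_card) simp
  moreover have "?S \<subseteq> R" using cub tri tri' by (auto simp: cubic_on_def)
  ultimately obtain y where y: "y \<in> R" "y \<notin> ?S" using card by (metis subsetI subset_antisym)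
  obtain z where yz: "(y, z) \<in> E" using cubic_on_nbrs[OF cub y(1)] by metis
  have z: "z \<notin> ?S" using closed[OF _ sy[OF yz]] y(2) by blast
  \<comment> \<open>The second switch follows the path \<open>w v v' x' x\<close>; it is allowed
    because the first one has removed the edge \<open>xw\<close>. Afterwards \<open>v\<close> and
    \<open>w'\<close> are the ends of a diamond with hubs \<open>v'\<close> and
    \<open>x'\<close>.\<close>
  let ?E1 = "switch E x w y z"
  let ?E2 = "switch ?E1 v w x' x"
  have ne: "y \<noteq> z" using irr[OF yz] .
  have st1: "tri_step E ?E1"
  proof (rule tri_step.break)
    show "distinct [v, x, w, y, z]" using dist y(2) z ne by auto
    show "(v, x) \<in> E" "(x, w) \<in> E" "(w, v) \<in> E" "(y, z) \<in> E" using tri adj_rev yz by auto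
    show "(x, y) \<notin> E" "(w, z) \<notin> E" using closed[of x y] closed[of w z] y(2) z by auto
  qed
  have st2: "tri_step ?E1 ?E2"
  proof (rule tri_step.make)
    show "distinct [w, v, v', x', x]" using dist by auto
    show "(w, v) \<in> ?E1" "(v, v') \<in> ?E1" "(v', x') \<in> ?E1" "(x', x) \<in> ?E1"
      using dist y(2) z tri' rungs adj_rev by (auto simp: switch_iff)
    show "(v, x') \<notin> ?E1" "(w, x) \<notin> ?E1"
      using nbrs(1)[of x'] dist y(2) z by (auto simp: switch_iff)
  qed
  have "(w', v) \<notin> E" using nbrs(6)[of v] dist by auto
  then have "diamond ?E2 v' x' w' v"
    using dist y(2) z tri' rungs adj_rev by (auto simp: diamond_def switch_iff)
  then have "reaches_K4 ?E2"
    by (rule diamond_reaches_K4[OF cubic_on_tri_step[OF st2 cubic_on_tri_step[OF st1 cub]]])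
  then show ?thesis by (intro reaches_K4_step[OF st1] reaches_K4_step[OF st2])
qed

lemma triangle_K23_reaches_K4:
  assumes cub: "cubic_on R E"
    and dist: "distinct [a, b, c, a', b', c', p, q]"
    and tri: "(a, b) \<in> E" "(a, c) \<in> E" "(b, c) \<in> E"
    and rungs: "(a, a') \<in> E" "(b, b') \<in> E" "(c, c') \<in> E"
    and bip: "(a', p) \<in> E" "(a', q) \<in> E" "(b', p) \<in> E" "(b', q) \<in> E" "(c', p) \<in> E" "(c', q) \<in> E"
  shows "reaches_K4 E"
proof -
  note sy = cubic_on_sym[OF cub]
  note adj_rev = tri[THEN sy] rungs[THEN sy] bip[THEN sy]
  have nbrs: "(a', u) \<in> E \<longleftrightarrow> u = a \<or> u = p \<or> u = q"
    "(p, u) \<in> E \<longleftrightarrow> u = a' \<or> u = b' \<or> u = c'" "(q, u) \<in> E \<longleftrightarrow> u = a' \<or> u = b' \<or> u = c'"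
    "(c, u) \<in> E \<longleftrightarrow> u = a \<or> u = b \<or> u = c'" for u
    by (rule cubic_on_nbrs3[OF cub]; use dist in \<open>auto simp: tri rungs bip adj_rev\<close>)+
  have non: "(a', b') \<notin> E" "(p, b) \<notin> E" "(a', b) \<notin> E" "(q, p) \<notin> E" "(c, a') \<notin> E"
    using nbrs(1)[of b'] nbrs(1)[of b] nbrs(2)[of b] nbrs(3)[of p] nbrs(4)[of a'] dist by auto
  \<comment> \<open>The first make move, along \<open>p a' q b' b\<close>, creates the edge
    \<open>pb\<close>. The second, along \<open>q a' a b p\<close>, trades it for
    \<open>a'b\<close>, so that \<open>a\<close> and \<open>b\<close> have both \<open>c\<close> and
    \<open>a'\<close> as common neighbours.\<close>
  let ?E1 = "switch E a' p b' b"
  let ?E2 = "switch ?E1 a' q b p"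
  have st1: "tri_step E ?E1"
    by (rule tri_step.make[where v = q]) (use dist adj_rev bip non in auto)
  have st2: "tri_step ?E1 ?E2"
    by (rule tri_step.make[where v = a]) (use dist tri adj_rev non in \<open>auto simp: switch_iff\<close>)
  have "diamond ?E2 a b c a'"
    using dist tri rungs non by (auto simp: diamond_def switch_iff)
  then have "reaches_K4 ?E2"
    by (rule diamond_reaches_K4[OF cubic_on_tri_step[OF st2 cubic_on_tri_step[OF st1 cub]]])
  then show ?thesis by (intro reaches_K4_step[OF st1] reaches_K4_step[OF st2])
qed

text \<open>If every extension to a diamond is blocked, the outer neighbours \<open>v'\<close>,
  \<open>x'\<close>, \<open>w'\<close> are distinct, and each further neighbour of one is equal or
  adjacent to the others. This determines the component: a prism if they are adjacent, the triangle
  matched to \<open>K_{2,3}\<close> if not.\<close>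

lemma triangle_reaches_K4:
  assumes cub: "cubic_on R E" and card: "card R \<noteq> 6"
    and tri: "(v, x) \<in> E" "(v, w) \<in> E" "(x, w) \<in> E"
  shows "reaches_K4 E"
proof (rule ccontr)
  assume no: "\<not> reaches_K4 E"
  note sy = cubic_on_sym[OF cub] and irr = cubic_on_irrefl[OF cub]
  note tri_rev = tri[THEN sy]
  note ne = tri[THEN irr]
  obtain v' where v': "distinct [x, w, v']" "\<And>u. (v, u) \<in> E \<longleftrightarrow> u = x \<or> u = w \<or> u = v'"
    using cubic_on_nbrs2[OF cub tri(1,2) ne(3)] by metis
  obtain x' where x': "distinct [v, w, x']" "\<And>u. (x, u) \<in> E \<longleftrightarrow> u = v \<or> u = w \<or> u = x'"
    using cubic_on_nbrs2[OF cub tri_rev(1) tri(3) ne(2)] by metis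
  obtain w' where w': "distinct [v, x, w']" "\<And>u. (w, u) \<in> E \<longleftrightarrow> u = v \<or> u = x \<or> u = w'"
    using cubic_on_nbrs2[OF cub tri_rev(2,3) ne(1)] by metis
  have rungs: "(v, v') \<in> E" "(x, x') \<in> E" "(w, w') \<in> E" using v' x' w' by auto
  note rungs_rev = rungs[THEN sy]
  have shared: "v' \<noteq> x'" "v' \<noteq> w'" "x' \<noteq> w'"
    using no triangle_shared_nbr_reaches_K4[OF cub tri rungs(1)]
      triangle_shared_nbr_reaches_K4[OF cub tri(2,1) tri_rev(3) rungs(1)]
      triangle_shared_nbr_reaches_K4[OF cub tri(3) tri_rev(1,2) rungs(2)] v' x' w' rungs by auto
  have dist: "distinct [v, x, w, v', x', w']"
    using shared v'(1) x'(1) w'(1) ne rungs[THEN irr] by auto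
  txt \<open>Otherwise the edge \<open>v'y\<close> could be traded for the missing edge of a diamond.\<close>
  have ext: "y = x' \<or> (y, x') \<in> E" if "(v', y) \<in> E" "y \<noteq> v" for y
    using triangle_extends_to_diamond[OF cub tri rungs(1,2) _ _ _ that] no dist by auto
  have ext': "y = w' \<or> (y, w') \<in> E" if "(v', y) \<in> E" "y \<noteq> v" for y
    using triangle_extends_to_diamond[OF cub tri(2,1) tri_rev(3) rungs(1,3) _ _ _ that] no dist by auto
  have ext_x: "y = v' \<or> (y, v') \<in> E" if "(x', y) \<in> E" "y \<noteq> x" for y
    using triangle_extends_to_diamond[OF cub tri_rev(1) tri(3,2) rungs(2,1) _ _ _ that] no dist by auto
  have ext_x': "y = w' \<or> (y, w') \<in> E" if "(x', y) \<in> E" "y \<noteq> x" for y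
    using triangle_extends_to_diamond[OF cub tri(3) tri_rev(1,2) rungs(2,3) _ _ _ that] no dist by auto
  have ext_w: "y = v' \<or> (y, v') \<in> E" if "(w', y) \<in> E" "y \<noteq> w" for y
    using triangle_extends_to_diamond[OF cub tri_rev(2,3) tri(1) rungs(3,1) _ _ _ that] no dist by auto
  \<comment> \<open>One edge among the outer neighbours forces all three: in the blocking conditions
    an endpoint of that edge serves as \<open>y\<close>.\<close>
  have "(v', x') \<in> E \<and> (v', w') \<in> E \<and> (x', w') \<in> E"
    if "(v', x') \<in> E \<or> (v', w') \<in> E \<or> (x', w') \<in> E"
    using that
  proof (elim disjE)
    assume a: "(v', x') \<in> E"
    then have "(x', w') \<in> E" using ext'[OF a] dist by auto
    moreover have "(v', w') \<in> E" using ext_x'[OF sy[OF a]] dist by auto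
    ultimately show ?thesis using a by blast
  next
    assume a: "(v', w') \<in> E"
    then have wx: "(w', x') \<in> E" using ext[OF a] dist by auto
    have "(x', v') \<in> E" using ext_w[OF wx] dist by auto
    with a wx show ?thesis using a sy by blast
  next
    assume a: "(x', w') \<in> E"
    then have "(w', v') \<in> E" using ext_x[OF a] dist by auto
    moreover have "(x', v') \<in> E" using ext_w[OF sy[OF a]] dist by auto
    ultimately show ?thesis using a sy by blast
  qed
  then consider (prism) "(v', x') \<in> E" "(v', w') \<in> E" "(x', w') \<in> E"
    | (none) "(v', x') \<notin> E" "(v', w') \<notin> E" "(x', w') \<notin> E" by blast
  then show False
  proof cases
    case prism
    then show False using prism_reaches_K4[OF cub card dist tri _ _ _ rungs] no by blast
  next
    case none
    obtain p q where pq: "distinct [v, p, q]" "\<And>u. (v', u) \<in> E \<longleftrightarrow> u = v \<or> u = p \<or> u = q"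
      using cubic_on_nbrs1[OF cub rungs_rev(1)] by metis
    have v'pq: "(v', p) \<in> E" "(v', q) \<in> E" using pq by auto
    \<comment> \<open>With no edges among the outer neighbours, the blocking conditions leave only
      adjacency, so \<open>p\<close> and \<open>q\<close> are joined to all three of them.\<close>
    have new: "y \<notin> {v, x, w, v', x', w'}" "(x', y) \<in> E" "(w', y) \<in> E" if "y \<in> {p, q}" for y
    proof -
      have y: "(v', y) \<in> E" "y \<noteq> v" using that v'pq pq(1) by auto
      show "y \<notin> {v, x, w, v', x', w'}"
        using y none irr[OF y(1)] sy[OF y(1)] x'(2)[of v'] w'(2)[of v'] dist by auto
      then show "(x', y) \<in> E" "(w', y) \<in> E"
        using ext[OF y] ext'[OF y] sy by auto
    qed
    have "distinct [v, x, w, v', x', w', p, q]"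
      using dist pq(1) new(1)[of p] new(1)[of q] by auto
    from triangle_K23_reaches_K4[OF cub this tri rungs v'pq] new no show False by blast
  qed
qed

section \<open>Triangle-free cubic graphs\<close>

lemma cubic_reaches_K4:
  assumes cub: "cubic_on R E" and card: "card R \<noteq> 6" and "R \<noteq> {}"
  shows "reaches_K4 E"
proof (cases "\<exists>v x w. (v, x) \<in> E \<and> (v, w) \<in> E \<and> (x, w) \<in> E")
  case True
  then show ?thesis using triangle_reaches_K4[OF cub card] by blast
next
  case False
  then have free: "(x, w) \<notin> E" if "(v, x) \<in> E" "(v, w) \<in> E" for v x w using that by blast
  note sy = cubic_on_sym[OF cub] and irr = cubic_on_irrefl[OF cub]
  show ?thesis
  proof (rule ccontr)
    assume no: "\<not> reaches_K4 E"
    \<comment> \<open>A make move along \<open>y x v w z\<close> would create the triangle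
      \<open>v x w\<close>. As \<open>xw\<close> is a nonedge by \<open>free\<close>, the only
      possible obstruction is the edge \<open>yz\<close>.\<close>
    have nomake: "(y, z) \<in> E"
      if "(v, x) \<in> E" "(v, w) \<in> E" "x \<noteq> w" "(x, y) \<in> E" "y \<noteq> v" "(w, z) \<in> E" "z \<noteq> v" "y \<noteq> z"
      for v x w y z
    proof (rule ccontr)
      assume yz: "(y, z) \<notin> E"
      have neq: "v \<noteq> x" "v \<noteq> w" "x \<noteq> y" "w \<noteq> z" "y \<noteq> w" "x \<noteq> z"
        using that irr free[OF that(1,2)] sy[OF that(6)] by metis+
      let ?E = "switch E x y w z"
      have st: "tri_step E ?E"
        by (rule tri_step.make[where v = v])
          (use that neq yz free[OF that(1,2)] sy[OF that(1)] sy[OF that(4)] in auto)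
      have "(v, x) \<in> ?E" "(v, w) \<in> ?E" "(x, w) \<in> ?E"
        using that neq by (auto simp: switch_iff)
      then show False
        using triangle_reaches_K4[OF cubic_on_tri_step[OF st cub] card] reaches_K4_step[OF st] no
        by blast
    qed
    have key: "(y, z) \<in> E"
      if h: "(v, x) \<in> E" "(v, w) \<in> E" "x \<noteq> w" "(x, y) \<in> E" "y \<noteq> v" "(w, z) \<in> E" "z \<noteq> v"
      for v x w y z
    proof (cases "y = z")
      case True
      obtain t where "distinct [v, z, t]" "\<And>u. (w, u) \<in> E \<longleftrightarrow> u = v \<or> u = z \<or> u = t"
        using cubic_on_nbrs2[OF cub sy[OF h(2)] h(6)] h(7) by metis
      then have "(z, t) \<in> E" "(w, t) \<in> E"
        using nomake[OF h(1-5), of t] True by auto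
      then show ?thesis using free h(6) by blast
    next
      case False
      then show ?thesis using nomake h by blast
    qed
    obtain v where "v \<in> R" using \<open>R \<noteq> {}\<close> by blast
    then obtain x w u where "distinct [x, w, u]" and N: "\<And>s. (v, s) \<in> E \<longleftrightarrow> s = x \<or> s = w \<or> s = u"
      using cubic_on_nbrs[OF cub] by metis
    then have vx: "(v, x) \<in> E" and vw: "(v, w) \<in> E" and vu: "(v, u) \<in> E"
      and xwu: "x \<noteq> w" "x \<noteq> u" "w \<noteq> u" by auto
    obtain p p' where p: "distinct [v, p, p']" "\<And>s. (x, s) \<in> E \<longleftrightarrow> s = v \<or> s = p \<or> s = p'"
      using cubic_on_nbrs1[OF cub sy[OF vx]] by metis
    obtain r s where rs: "distinct [v, r, s]" "\<And>t. (w, t) \<in> E \<longleftrightarrow> t = v \<or> t = r \<or> t = s"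
      using cubic_on_nbrs1[OF cub sy[OF vw]] by metis
    obtain t t' where t: "distinct [v, t, t']" "\<And>s. (u, s) \<in> E \<longleftrightarrow> s = v \<or> s = t \<or> s = t'"
      using cubic_on_nbrs1[OF cub sy[OF vu]] by metis
    have pr: "(p, r) \<in> E" and ps: "(p, s) \<in> E" and pt: "(p, t) \<in> E" and px: "(p, x) \<in> E"
      using key[OF vx vw xwu(1), of p] key[OF vx vu xwu(2), of p] p rs t sy[of x p] by auto
    have rt: "(r, t) \<in> E" and st: "(s, t) \<in> E"
      using key[OF vw vu xwu(3), of _ t] rs t by auto
    have "x \<noteq> r" "x \<noteq> s" "x \<noteq> t"
      using free[OF vx vw] free[OF vx vu] rs(2)[of x] t(2)[of x] sy[of w x] sy[of u x] by auto
    \<comment> \<open>The neighbours of \<open>p\<close> are exactly \<open>r\<close>,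
      \<open>s\<close> and \<open>x\<close>, so \<open>t\<close>, being adjacent to
      \<open>p\<close>, is one of them. Either remaining choice turns \<open>rt\<close> or
      \<open>st\<close> into a loop.\<close>
    then have "t = r \<or> t = s"
      using cubic_on_nbrs3[OF cub pr ps px] rs(1) pt by auto
    then show False using rt st irr by blast
  qed
qed

section \<open>Splitting off complete components\<close>

text \<open>For a partition into blocks of size four this is the target: the edge set of a disjoint
  union of copies of \<open>K4\<close>.\<close>

definition block_cliques :: "'a set set \<Rightarrow> ('a \<times> 'a) set" where
  "block_cliques P = {(u, v). u \<noteq> v \<and> (\<exists>A\<in>P. u \<in> A \<and> v \<in> A)}"

text \<open>The move takes place on vertices of \<open>S\<close>, which \<open>F\<close> does not
  touch, so its nonadjacency conditions survive and no arc of \<open>F\<close> is deleted.\<close>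

lemma tri_step_disjoint_union:
  assumes "tri_step E E'" "E \<subseteq> S \<times> S" "F \<subseteq> (- S) \<times> (- S)"
  shows "tri_step (E \<union> F) (E' \<union> F)"
  using assms(1)
proof cases
  case (make y x v w z)
  have "x \<in> S" "y \<in> S" "w \<in> S" "z \<in> S" using make assms(2) by auto
  then have "E' \<union> F = switch (E \<union> F) x y w z" and "(x, w) \<notin> F" "(y, z) \<notin> F"
    using assms(3) make(1) by (auto simp: switch_iff)
  then show ?thesis using make by (auto intro: tri_step.make[where v = v])
next
  case (break v x w y z)
  have "x \<in> S" "y \<in> S" "w \<in> S" "z \<in> S" using break assms(2) by auto
  then have "E' \<union> F = switch (E \<union> F) x w y z" and "(x, y) \<notin> F" "(w, z) \<notin> F"
    using assms(3) break(1) by (auto simp: switch_iff)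
  then show ?thesis using break by (auto intro: tri_step.break[where v = v])
qed

lemma tri_steps_disjoint_union:
  assumes "tri_step\<^sup>*\<^sup>* E E'" "cubic_on S E" "F \<subseteq> (- S) \<times> (- S)"
  shows "tri_step\<^sup>*\<^sup>* (E \<union> F) (E' \<union> F)"
  using assms(1)
proof induction
  case (step E1 E2)
  have "E1 \<subseteq> S \<times> S"
    using cubic_on_tri_steps[OF step(1) assms(2)] by (auto simp: cubic_on_def)
  from step.IH tri_step_disjoint_union[OF step(2) this assms(3)] show ?case
    by (rule rtranclp.rtrancl_into_rtrancl)
qed simp

text \<open>Each vertex of the complete graph already has its three neighbours there, so no edge
  leaves it, and the other vertices keep their full neighbourhoods.\<close>

lemma cubic_on_minus_K4:
  assumes cub: "cubic_on R E" and K4: "is_K4 E a b c d"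
  defines "A \<equiv> {a, b, c, d}"
  shows "A \<subseteq> R" and "cubic_on (R - A) (E \<inter> (R - A) \<times> (R - A))"
    and "E = E \<inter> (R - A) \<times> (R - A) \<union> block_cliques {A}"
proof -
  note sy = cubic_on_sym[OF cub]
  have K: "distinct [a, b, c, d]" "(a, b) \<in> E" "(a, c) \<in> E" "(a, d) \<in> E" "(b, c) \<in> E"
    "(b, d) \<in> E" "(c, d) \<in> E"
    using K4 by (auto simp: is_K4_def)
  note adj = K(2-7) K(2-7)[THEN sy]
  have "(a, u) \<in> E \<longleftrightarrow> u = b \<or> u = c \<or> u = d" "(b, u) \<in> E \<longleftrightarrow> u = a \<or> u = c \<or> u = d"
    "(c, u) \<in> E \<longleftrightarrow> u = a \<or> u = b \<or> u = d" "(d, u) \<in> E \<longleftrightarrow> u = a \<or> u = b \<or> u = c" for u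
    by (rule cubic_on_nbrs3[OF cub]; use K(1) in \<open>auto simp: adj\<close>)+
  then have N: "(s, t) \<in> E \<longleftrightarrow> t \<in> A \<and> s \<noteq> t" if "s \<in> A" for s t
    using that K(1) by (auto simp: A_def)
  have sub: "E \<subseteq> R \<times> R" using cub by (simp add: cubic_on_def)
  show "A \<subseteq> R" using K sub by (auto simp: A_def)
  show "E = E \<inter> (R - A) \<times> (R - A) \<union> block_cliques {A}"
    using N sy sub by (auto simp: block_cliques_def)
  have "(E \<inter> (R - A) \<times> (R - A)) `` {v} = E `` {v}" if "v \<in> R - A" for v
    using that N sy sub by blast
  then show "cubic_on (R - A) (E \<inter> (R - A) \<times> (R - A))"
    using cub by (auto simp: cubic_on_def sym_def irrefl_def)
qed

lemma block_cliques_insert: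
  "block_cliques (insert A P) = block_cliques P \<union> block_cliques {A}"
  by (auto simp: block_cliques_def)

lemma cubic_steps_to_K4_partition:
  assumes "cubic_on R E" "4 dvd card R"
  shows "\<exists>P. partition_on R P \<and> (\<forall>A\<in>P. card A = 4) \<and> tri_step\<^sup>*\<^sup>* E (block_cliques P)"
  using assms
proof (induction "card R" arbitrary: R E rule: less_induct)
  case less
  show ?case
  proof (cases "R = {}")
    case True
    then have "E = block_cliques {}"
      using less.prems by (auto simp: cubic_on_def block_cliques_def)
    then show ?thesis using True by (intro exI[of _ "{}"]) (auto simp: partition_on_def)
  next
    case False
    have fin: "finite R" using less.prems by (simp add: cubic_on_def)
    have "card R \<noteq> 6" using less.prems(2) by auto
    then obtain E1 a b c d where steps: "tri_step\<^sup>*\<^sup>* E E1" and K4: "is_K4 E1 a b c d"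
      using cubic_reaches_K4[OF less.prems(1) _ False] by (auto simp: reaches_K4_def)
    define A where "A = {a, b, c, d}"
    let ?E0 = "E1 \<inter> (R - A) \<times> (R - A)"
    note rest = cubic_on_minus_K4[OF cubic_on_tri_steps[OF steps less.prems(1)] K4, folded A_def]
    have cA: "card A = 4" using K4 by (auto simp: A_def is_K4_def)
    have cRA: "card (R - A) = card R - 4"
      using card_Diff_subset[OF _ rest(1)] cA finite_subset[OF rest(1) fin] by simp
    have "card R \<ge> 4" using card_mono[OF fin rest(1)] cA by simp
    then have "card (R - A) < card R" "4 dvd card (R - A)"
      using cRA less.prems(2) by (auto intro: dvd_diff_nat)
    from less.hyps[OF this(1) rest(2) this(2)]
    obtain P where P: "partition_on (R - A) P" "\<forall>B\<in>P. card B = 4"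
      and st: "tri_step\<^sup>*\<^sup>* ?E0 (block_cliques P)" by blast
    \<comment> \<open>The moves found on \<open>R - A\<close> are replayed beside the finished
      component on \<open>A\<close>.\<close>
    have "tri_step\<^sup>*\<^sup>* (?E0 \<union> block_cliques {A}) (block_cliques P \<union> block_cliques {A})"
      by (rule tri_steps_disjoint_union[OF st rest(2)]) (auto simp: block_cliques_def)
    then have "tri_step\<^sup>*\<^sup>* E1 (block_cliques (insert A P))"
      by (simp only: rest(3)[symmetric] block_cliques_insert[of A P])
    moreover have "partition_on R (insert A P)"
    proof -
      have "disjnt A (\<Union>P)" using partition_onD1[OF P(1)] by (auto simp: disjnt_def)
      then show ?thesis using P(1) rest(1) by (simp add: partition_on_insert) (simp add: A_def)
    qed
    ultimately show ?thesis
      using P(2) cA steps by (intro exI[of _ "insert A P"]) (auto intro: rtranclp_trans)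
  qed
qed

section \<open>From edge sets to the flip graph\<close>

lemma cubic_graphs_iff_cubic_on:
  "G \<in> cubic_graphs n \<longleftrightarrow> pverts G = {1..n} \<and> cubic_on {1..n} (parcs G)"
proof -
  have deg: "out_degree (with_proj G) v = card (parcs G `` {v})" for v
  proof -
    have "out_arcs (with_proj G) v = Pair v ` (parcs G `` {v})"
      by (auto simp: out_arcs_def)
    then show ?thesis by (simp add: out_degree_def card_image inj_on_def)
  qed
  show ?thesis
  proof
    assume G: "G \<in> cubic_graphs n"
    then interpret pair_graph G by (simp add: cubic_graphs_def)
    show "pverts G = {1..n} \<and> cubic_on {1..n} (parcs G)"
      using G deg by (auto simp: cubic_graphs_def cubic_on_def sym_def irrefl_def
        intro: arcs_symmetric dest: no_loops' in_arcsD1 in_arcsD2)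
  next
    assume G: "pverts G = {1..n} \<and> cubic_on {1..n} (parcs G)"
    then have "finite (parcs G)"
      by (auto simp: cubic_on_def intro: finite_subset)
    with G have "pair_graph G"
      by unfold_locales (auto simp: cubic_on_def symmetric_def irrefl_def)
    then show "G \<in> cubic_graphs n"
      using G deg by (auto simp: cubic_graphs_def cubic_on_def)
  qed
qed

lemma tri_step_triangle_move:
  assumes G: "G \<in> cubic_graphs n" and step: "tri_step (parcs G) E"
  shows "triangle_move G (G\<lparr>parcs := E\<rparr>)" and "G\<lparr>parcs := E\<rparr> \<in> cubic_graphs n"
proof -
  show "G\<lparr>parcs := E\<rparr> \<in> cubic_graphs n"
    using G cubic_on_tri_step[OF step] by (simp add: cubic_graphs_iff_cubic_on)
  note iff = cubic_graphs_edge_iff(1)[OF G]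
  show "triangle_move G (G\<lparr>parcs := E\<rparr>)"
    using step
  proof cases
    case (make y x v w z)
    then have "make_applies G y x v w z"
      unfolding make_applies_def iff by simp
    moreover have "G\<lparr>parcs := E\<rparr> = make_move G y x v w z"
      using make by (simp add: make_move_def switch_def)
    ultimately show ?thesis unfolding triangle_move_def by blast
  next
    case (break v x w y z)
    then have "break_applies G v x w y z"
      unfolding break_applies_def iff by auto
    moreover have "G\<lparr>parcs := E\<rparr> = break_move G v x w y z"
      using break by (simp add: break_move_def switch_def)
    ultimately show ?thesis unfolding triangle_move_def by blast
  qed
qed

lemma wf_flip_graph: "wf_digraph (with_proj (flip_graph n))"
  by unfold_locales (auto simp: flip_graph_def)

text \<open>Membership in \<open>cubic_graphs n\<close> is carried through the induction because
  arcs of \<open>flip_graph n\<close> require it at both ends, and reflexive reachability requires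
  \<open>G\<close> to be a vertex.\<close>

lemma tri_steps_reachable:
  assumes "tri_step\<^sup>*\<^sup>* (parcs G) E" "G \<in> cubic_graphs n"
  shows "G \<rightarrow>\<^sup>*\<^bsub>with_proj (flip_graph n)\<^esub> (G\<lparr>parcs := E\<rparr>) \<and> G\<lparr>parcs := E\<rparr> \<in> cubic_graphs n"
  using assms(1)
proof induction
  case base
  interpret wf_digraph "with_proj (flip_graph n)" by (rule wf_flip_graph)
  show ?case using assms(2) reachable_refl[of G] by (simp add: flip_graph_def)
next
  case (step E1 E2)
  interpret wf_digraph "with_proj (flip_graph n)" by (rule wf_flip_graph)
  let ?G1 = "G\<lparr>parcs := E1\<rparr>"
  have "triangle_move ?G1 (G\<lparr>parcs := E2\<rparr>)" "G\<lparr>parcs := E2\<rparr> \<in> cubic_graphs n"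
    using tri_step_triangle_move[of ?G1 n E2] step by auto
  moreover from this have "?G1 \<rightarrow>\<^bsub>with_proj (flip_graph n)\<^esub> (G\<lparr>parcs := E2\<rparr>)"
    using step.IH by (simp add: flip_graph_def)
  ultimately show ?case using step.IH reachable_adj_trans by blast
qed

section \<open>Components of a disjoint union of cliques\<close>

text \<open>Any bijection of the vertices works: the arcs are all pairs of distinct vertices, so
  applying it to both ends maps arcs onto arcs.\<close>

lemma block_clique_iso_complete_graph:
  assumes "card A = k" "finite A"
  shows "digraph_iso (with_proj \<lparr>pverts = A, parcs = block_cliques {A}\<rparr>) (with_proj (complete_graph k))"
proof -
  let ?C = "\<lparr>pverts = A, parcs = block_cliques {A}\<rparr>"
  obtain f where "bij_betw f {1..k} A"
    using assms ex_bij_betw_nat_finite_1 by blast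
  then obtain g where g: "bij_betw g A {1..k}" using bij_betw_inv by blast
  then have inj: "inj_on g A" and im: "g ` A = {1..k}" by (auto simp: bij_betw_def)
  let ?h = "\<lparr>iso_verts = g, iso_arcs = map_prod g g, iso_head = snd, iso_tail = fst\<rparr>"
  have "wf_digraph (with_proj ?C)" by unfold_locales (auto simp: block_cliques_def)
  moreover have "inj_on (map_prod g g) (block_cliques {A})"
    using inj by (auto simp: inj_on_def block_cliques_def)
  ultimately have "pre_digraph.digraph_isomorphism (with_proj ?C) ?h"
    using inj by (auto simp: pre_digraph.digraph_isomorphism_def)
  moreover have "map_prod g g ` block_cliques {A} = {(u, v). u \<in> {1..k} \<and> v \<in> {1..k} \<and> u \<noteq> v}"
    unfolding im[symmetric] using inj by (force simp: block_cliques_def inj_on_def)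
  then have "with_proj (complete_graph k) = app_iso ?h (with_proj ?C)"
    using im by (simp add: app_iso_def complete_graph_def with_proj_def)
  ultimately show ?thesis unfolding digraph_iso_def by blast
qed

text \<open>Reachability coincides with lying in a common block: a walk cannot leave its block
  because blocks are disjoint, and two distinct vertices of a block are joined by an arc.\<close>

lemma sccs_verts_block_cliques:
  assumes P: "partition_on R P" and V: "pverts H = R" "parcs H = block_cliques P"
  shows "wf_digraph (with_proj H)" and "pre_digraph.sccs_verts (with_proj H) = P"
proof -
  show wf: "wf_digraph (with_proj H)"
    using assms by unfold_locales (auto simp: block_cliques_def partition_on_def)
  interpret wf_digraph "with_proj H" by (rule wf)
  have same: "A = B" if "A \<in> P" "B \<in> P" "u \<in> A" "u \<in> B" for A B u
    using P that by (auto simp: partition_on_def disjoint_def)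
  have reach: "u \<rightarrow>\<^sup>*\<^bsub>with_proj H\<^esub> v \<longleftrightarrow> (\<exists>A\<in>P. u \<in> A \<and> v \<in> A)" for u v
  proof
    assume "u \<rightarrow>\<^sup>*\<^bsub>with_proj H\<^esub> v"
    then show "\<exists>A\<in>P. u \<in> A \<and> v \<in> A"
    proof (induction rule: reachable_induct)
      case base
      then show ?case using P V by (auto simp: partition_on_def)
    next
      case (step x y)
      from step.IH obtain A where "A \<in> P" "u \<in> A" "x \<in> A" by blast
      moreover from step.hyps(2) obtain B where "B \<in> P" "x \<in> B" "y \<in> B"
        using V by (auto simp: block_cliques_def)
      ultimately show ?case using same[of A B x] by blast
    qed
  next
    assume "\<exists>A\<in>P. u \<in> A \<and> v \<in> A"
    moreover from this have "u \<in> R" using P by (auto simp: partition_on_def)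
    ultimately show "u \<rightarrow>\<^sup>*\<^bsub>with_proj H\<^esub> v"
      using V by (cases "u = v") (auto simp: block_cliques_def intro!: reachable_adjI)
  qed
  show "sccs_verts = P"
  proof (intro equalityI subsetI)
    fix S assume S: "S \<in> sccs_verts"
    then obtain u where u: "u \<in> S" by (auto simp: sccs_verts_def)
    with S have "u \<rightarrow>\<^sup>*\<^bsub>with_proj H\<^esub> u" by (auto simp: sccs_verts_def)
    then obtain A where A: "A \<in> P" "u \<in> A" using reach by blast
    have "S = A"
      using S u A same unfolding sccs_verts_def reach by blast
    then show "S \<in> P" using A by simp
  next
    fix A assume "A \<in> P"
    moreover from this have "A \<noteq> {}" using P by (auto simp: partition_on_def)
    ultimately show "A \<in> sccs_verts"
      using same unfolding sccs_verts_def reach by blast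
  qed
qed

lemma K4_partition_in_K4_graphs:
  assumes H: "H \<in> cubic_graphs n" and P: "partition_on {1..n} P" "\<forall>A\<in>P. card A = 4"
    and parcs: "parcs H = block_cliques P"
  shows "H \<in> K4_graphs n"
proof -
  have verts: "pverts H = {1..n}" using H by (simp add: cubic_graphs_def)
  note scc = sccs_verts_block_cliques[OF P(1) verts parcs]
  interpret wf_digraph "with_proj H" by (rule scc(1))
  \<comment> \<open>Counting vertices block by block gives the number of components, as every block
    has four vertices.\<close>
  have "n = (\<Sum>A\<in>P. card A)"
  proof -
    have "card (\<Union>P) = sum card P"
      using P(1) by (intro card_Union_disjoint)
        (auto simp: partition_on_def disjoint_def pairwise_def disjnt_def intro: rev_finite_subset)
    then show ?thesis using P(1) by (simp add: partition_on_def)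
  qed
  then have "4 * card sccs = n"
    using P(2) card_sccs_verts scc(2) by simp
  moreover have "digraph_iso C (with_proj (complete_graph 4))" if C: "C \<in> sccs" for C
  proof -
    obtain A where A: "A \<in> P" "C = with_proj H \<restriction> A"
      using C scc(2) sccs_conv_sccs_verts by auto
    \<comment> \<open>A strongly connected component is the subgraph induced by a block, and its
      arcs are those of the clique on that block.\<close>
    have "{e \<in> block_cliques P. fst e \<in> A \<and> snd e \<in> A} = block_cliques {A}"
      using A(1) by (auto simp: block_cliques_def)
    then have "C = with_proj \<lparr>pverts = A, parcs = block_cliques {A}\<rparr>"
      using A(2) parcs by (simp add: induce_subgraph_def with_proj_def)
    moreover have "card A = 4" using P(2) A(1) by blast
    ultimately show ?thesis using block_clique_iso_complete_graph[of A 4] by (simp add: card_ge_0_finite)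
  qed
  ultimately show ?thesis using H by (simp add: K4_graphs_def)
qed

theorem theorem4:
  fixes n :: nat and G :: "nat pair_pre_digraph"
  assumes "n mod 4 = 0"
    and "G \<in> cubic_graphs n"
  shows "\<exists>H \<in> K4_graphs n. \<exists>p. pre_digraph.apath (with_proj (flip_graph n)) G p H"
proof -
  interpret wf_digraph "with_proj (flip_graph n)" by (rule wf_flip_graph)
  have "cubic_on {1..n} (parcs G)" "4 dvd card {1..n}"
    using assms by (auto simp: cubic_graphs_iff_cubic_on)
  then obtain P where P: "partition_on {1..n} P" "\<forall>A\<in>P. card A = 4"
    and steps: "tri_step\<^sup>*\<^sup>* (parcs G) (block_cliques P)"
    using cubic_steps_to_K4_partition by blast
  let ?H = "G\<lparr>parcs := block_cliques P\<rparr>"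
  have "?H \<in> K4_graphs n"
    using tri_steps_reachable[OF steps assms(2)] by (intro K4_partition_in_K4_graphs[OF _ P]) auto
  \<comment> \<open>The sequence of moves may revisit graphs; reachability yields a walk, which can
    be shortened to a path without repeated vertices.\<close>
  moreover have "\<exists>p. apath G p ?H"
    using tri_steps_reachable[OF steps assms(2)] reachable_apath by blast
  ultimately show ?thesis by blast
qed

end
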